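(* Let $\mathcal A$ be a DFA and let $\mathcal A_{min}$ be the minimum DFA recognizing $\mathcal L(\mathcal A)$. Then $\mathcal L(\mathcal A)$ is not Wheeler if and only if the square automaton $\mathcal A_{min}^2$ contains a cycle $(u_1,v_1)\to(u_2,v_2)\to\dots\to(u_k,v_k)\to(u_1,v_1)$ such that, for every $1\le i\le k$, the following hold: (i) $u_i\ne v_i$ and (ii) $\mathcal I(u_i)\cap\mathcal I(v_i)\ne\emptyset$.
   Context: A DFA is a quintuple $\mathcal A=(Q,\Sigma,\delta,s,F)$ with finite state set $Q$, finite alphabet $\Sigma$ equipped with a fixed total order $\prec$, (partial) transition function $\delta:Q\times\Sigma\to Q$, source $s\in Q$ and final states $F\subseteq Q$; every state is reachable from $s$. $\delta$ is extended to words as usual. For $u\in Q$, $I_u=\{\alpha\in\Sigma^*:\delta(s,\alpha)=u\}$, and $\mathcal L(\mathcal A)=\bigcup_{u\in F}I_u$. Wheeler DFA: a DFA for which there is a total (strict) order $<$ on $Q$ such that (i) $s<u$ for every $u\in Q\setminus\{s\}$; (ii) if $u'=\delta(u,a)$, $v'=\delta(v,b)$ and $a\prec b$, then $u'<v'$; (iii) if $u'=\delta(u,a)\ne\delta(v,a)=v'$ and $u<v$, then $u'<v'$. A regular language is Wheeler if it is $\mathcal L(\mathcal A')$ for some Wheeler DFA $\mathcal A'$. The minimum DFA $\mathcal A_{min}=(Q_{min},\Sigma,\delta_{min},s_{min},F_{min})$ of a regular language is unique up to isomorphism; it has a partial transition function, and every state is reachable from the source and can reach a final state. Square automaton: $\mathcal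 A_{min}^2$ has state set $Q_{min}\times Q_{min}$, source $(s_{min},s_{min})$, final states $F_{min}\times F_{min}$, and transitions $\delta'((u,v),a)=(\delta_{min}(u,a),\delta_{min}(v,a))$ (defined when both components are defined). An arrow $(u,v)\to(u',v')$ means that $\delta'((u,v),a)=(u',v')$ for some $a\in\Sigma$. $\Sigma^\omega$ denotes the set of left-infinite strings over $\Sigma$ (having a last character and extending infinitely to the left). The co-lexicographic order $\prec$ on $\Sigma^*\cup\Sigma^\omega$ compares strings from right to left: $\epsilon\prec\alpha$ for every $\alpha\neq\epsilon$, and $\alpha'a\prec\beta'b$ (with $a,b\in\Sigma$) iff $a\prec b$, or $a=b$ and $\alpha'\prec\beta'$ (so $\alpha \prec \beta$ if $\alpha$ is a finite proper suffix of $\beta$, and otherwise the rightmost differing characters decide). For a state $u$, $\inf I_u$ and $\sup I_u$ are the greatest lower bound and the least upper bound of $I_u$ in $(\Sigma^*\cup\Sigma^\omega,\preceq)$, and $\mathcal I(u)=(\inf I_u,\sup I_u)$ is the open interval of all $\gamma\in\Sigma^*\cup\Sigma^\omega$ with $\inf I_u\prec\gamma\prec\sup I_u$. In the claim, $I_u$ and $\mathcal I(u)$ refer to states $u$ of $\mathcal A_{min}$. *)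

theory Defs
  imports Main
begin

(* A value of type 'a lstring is either a finite string or a left-infinite one:
   the codatatype is the disjoint union of the finite strings and of the left-infinite
   strings over 'a.  Snoc x a is the string x followed by its last character a. *)

codatatype 'a lstring = Eps | Snoc "'a lstring" 'a

definition of_word :: "'a list \<Rightarrow> 'a lstring" where
  "of_word w = foldl Snoc Eps w"

(* The co-lexicographic order.  The least fixed point is the right reading also on infinite
   strings: x < y holds iff this is decided after finitely many characters from the right. *)

inductive colex_less :: "'a::linorder lstring \<Rightarrow> 'a lstring \<Rightarrow> bool" where
  Eps: "colex_less Eps (Snoc y b)"
| last: "a < b \<Longrightarrow> colex_less (Snoc x a) (Snoc y b)"
| init: "colex_less x y \<Longrightarrow> colex_less (Snoc x a) (Snoc y a)"

inductive_cases colex_less_SnocE: "colex_less (Snoc x a) z"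

lemma colex_less_Snoc_iff:
  "colex_less (Snoc x a) (Snoc y b) \<longleftrightarrow> a < b \<or> a = b \<and> colex_less x y"
  by (auto elim: colex_less_SnocE intro: colex_less.intros)

lemma colex_less_neq: "colex_less x y \<Longrightarrow> x \<noteq> y"
  by (induction rule: colex_less.induct) auto

lemma colex_less_trans: "colex_less x y \<Longrightarrow> colex_less y z \<Longrightarrow> colex_less x z"
proof (induction arbitrary: z rule: colex_less.induct)
  case (Eps y b)
  then show ?case by (auto elim!: colex_less_SnocE intro: colex_less.intros)
next
  case (last a b x y)
  then show ?case
    by (auto elim!: colex_less_SnocE intro: colex_less.intros dest: less_trans)
next
  case (init x y a)
  then show ?case by (auto elim!: colex_less_SnocE intro: colex_less.intros)
qed

lemma colex_less_total:
  assumes "\<not> colex_less x y" and "\<not> colex_less y x"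
  shows "x = y"
  using assms
proof (coinduction arbitrary: x y rule: lstring.coinduct_strong)
  case Eq_lstring
  then show ?case
    by (cases x; cases y) (auto simp: colex_less_Snoc_iff intro: colex_less.Eps)
qed

instantiation lstring :: (linorder) linorder
begin

definition less_lstring :: "'a lstring \<Rightarrow> 'a lstring \<Rightarrow> bool" where
  "x < y \<longleftrightarrow> colex_less x y"

definition less_eq_lstring :: "'a lstring \<Rightarrow> 'a lstring \<Rightarrow> bool" where
  "x \<le> y \<longleftrightarrow> x = y \<or> colex_less x y"

instance
proof
  fix x y z :: "'a lstring"
  have asym: "colex_less x y \<Longrightarrow> \<not> colex_less y x"
    using colex_less_trans colex_less_neq by blast
  show "x < y \<longleftrightarrow> x \<le> y \<and> \<not> y \<le> x"
    using asym colex_less_neq[of x y] by (auto simp: less_lstring_def less_eq_lstring_def)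
  show "x \<le> x" by (simp add: less_eq_lstring_def)
  show "x \<le> y \<Longrightarrow> y \<le> z \<Longrightarrow> x \<le> z"
    using colex_less_trans by (auto simp: less_eq_lstring_def)
  show "x \<le> y \<Longrightarrow> y \<le> x \<Longrightarrow> x = y"
    using asym by (auto simp: less_eq_lstring_def)
  show "x \<le> y \<or> y \<le> x"
    using colex_less_total[of x y] by (auto simp: less_eq_lstring_def)
qed

end

(* Over a finite alphabet every set S of strings has a least upper bound: its last character
   is the greatest last character occurring in S, and so on to the left. *)

primcorec colex_lub :: "'a::{finite,linorder} lstring set \<Rightarrow> 'a lstring" where
  "colex_lub S =
    (if S \<subseteq> {Eps} then Eps
     else Snoc (colex_lub {x. Snoc x (Max {a. \<exists>x. Snoc x a \<in> S}) \<in> S})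
       (Max {a. \<exists>x. Snoc x a \<in> S}))"

lemma colex_lub_Snoc:
  assumes "colex_lub S = Snoc y m"
  shows "y = colex_lub {x. Snoc x m \<in> S}" and "\<exists>x. Snoc x m \<in> S"
    and "Snoc x a \<in> S \<Longrightarrow> a \<le> m"
proof -
  have ne: "\<not> S \<subseteq> {Eps}"
    using assms colex_lub.ctr(1)[of S] by auto
  have m: "m = Max {a. \<exists>x. Snoc x a \<in> S}" and y: "y = colex_lub {x. Snoc x m \<in> S}"
    using colex_lub.ctr(2)[OF ne] by (simp_all only: assms lstring.inject)
  obtain z where "z \<in> S" "z \<noteq> Eps" using ne by auto
  then have "{a. \<exists>x. Snoc x a \<in> S} \<noteq> {}" by (cases z) auto
  then have "m \<in> {a. \<exists>x. Snoc x a \<in> S}" unfolding m by (intro Max_in) auto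
  then show "\<exists>x. Snoc x m \<in> S" by simp
  show "y = colex_lub {x. Snoc x m \<in> S}" by (fact y)
  show "a \<le> m" if "Snoc x a \<in> S" unfolding m using that by (intro Max_ge) auto
qed

lemma colex_lub_Eps: "colex_lub S = Eps \<Longrightarrow> S \<subseteq> {Eps}"
  using colex_lub.ctr(2)[of S] by (metis lstring.distinct(1))

lemma colex_lub_upper:
  assumes "x \<in> S" shows "x \<le> colex_lub S"
proof (rule ccontr)
  assume "\<not> x \<le> colex_lub S"
  then have "colex_less (colex_lub S) x" by (simp add: not_le less_lstring_def)
  then show False using assms
  proof (induction "colex_lub S" x arbitrary: S rule: colex_less.induct)
    case (Eps y b)
    then show ?case using colex_lub_Eps[of S] by auto
  next
    case (last a b x y)
    then show ?case using colex_lub_Snoc(3)[of S x a y b] by auto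
  next
    case (init x y a)
    then show ?case using colex_lub_Snoc(1)[of S x a] by auto
  qed
qed

lemma colex_lub_least:
  assumes "\<And>x. x \<in> S \<Longrightarrow> x \<le> z" shows "colex_lub S \<le> z"
proof (rule ccontr)
  assume "\<not> colex_lub S \<le> z"
  then have "colex_less z (colex_lub S)" by (simp add: not_le less_lstring_def)
  then have "\<exists>x\<in>S. colex_less z x"
  proof (induction z "colex_lub S" arbitrary: S rule: colex_less.induct)
    case (Eps y b)
    then show ?case using colex_lub_Snoc(2)[of S y b] by (auto intro: colex_less.intros)
  next
    case (last a b x y)
    then show ?case using colex_lub_Snoc(2)[of S y b] by (auto intro: colex_less.intros)
  next
    case (init x y a)
    then obtain w where "Snoc w a \<in> S" "colex_less x w"
      using colex_lub_Snoc(1)[of S y a] by auto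
    then show ?case by (auto intro: colex_less.intros)
  qed
  then show False using assms by (force simp: less_lstring_def[symmetric] dest: leD)
qed

instantiation lstring :: ("{finite,linorder}") complete_linorder
begin

definition inf_lstring :: "'a lstring \<Rightarrow> 'a lstring \<Rightarrow> 'a lstring" where
  "inf_lstring = min"

definition sup_lstring :: "'a lstring \<Rightarrow> 'a lstring \<Rightarrow> 'a lstring" where
  "sup_lstring = max"

definition Sup_lstring :: "'a lstring set \<Rightarrow> 'a lstring" where
  "Sup S = colex_lub S"

definition Inf_lstring :: "'a lstring set \<Rightarrow> 'a lstring" where
  "Inf S = colex_lub {z. \<forall>x\<in>S. z \<le> x}"

definition bot_lstring :: "'a lstring" where
  "bot_lstring = colex_lub {}"

definition top_lstring :: "'a lstring" where
  "top_lstring = colex_lub UNIV"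

instance
proof
  fix x y z :: "'a lstring" and S :: "'a lstring set"
  show "inf x y \<le> x" "inf x y \<le> y" by (simp_all add: inf_lstring_def)
  show "x \<le> y \<Longrightarrow> x \<le> z \<Longrightarrow> x \<le> inf y z" by (simp add: inf_lstring_def)
  show "x \<le> sup x y" "y \<le> sup x y" by (simp_all add: sup_lstring_def)
  show "y \<le> x \<Longrightarrow> z \<le> x \<Longrightarrow> sup y z \<le> x" by (simp add: sup_lstring_def)
  show "x \<in> S \<Longrightarrow> Inf S \<le> x"
    unfolding Inf_lstring_def by (rule colex_lub_least) simp
  show "(\<And>x. x \<in> S \<Longrightarrow> z \<le> x) \<Longrightarrow> z \<le> Inf S"
    unfolding Inf_lstring_def by (rule colex_lub_upper) simp
  show "x \<in> S \<Longrightarrow> x \<le> Sup S"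
    unfolding Sup_lstring_def by (rule colex_lub_upper)
  show "(\<And>x. x \<in> S \<Longrightarrow> x \<le> z) \<Longrightarrow> Sup S \<le> z"
    unfolding Sup_lstring_def by (rule colex_lub_least)
  show "Inf {} = (top :: 'a lstring)"
    by (simp add: Inf_lstring_def top_lstring_def)
  show "Sup {} = (bot :: 'a lstring)"
    by (simp add: Sup_lstring_def bot_lstring_def)
qed

end

(* The alphabet is the whole type 'a; None means that a transition is undefined. *)

record ('q, 'a) automaton =
  states :: "'q set"
  trans :: "'q \<Rightarrow> 'a \<Rightarrow> 'q option"
  source :: 'q
  finals :: "'q set"

fun run :: "('q, 'a) automaton \<Rightarrow> 'q \<Rightarrow> 'a list \<Rightarrow> 'q option" where
  "run A u [] = Some u"
| "run A u (a # w) = Option.bind (trans A u a) (\<lambda>v. run A v w)"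

definition words_to :: "('q, 'a) automaton \<Rightarrow> 'q \<Rightarrow> 'a list set" where
  "words_to A u = {w. run A (source A) w = Some u}"

definition language :: "('q, 'a) automaton \<Rightarrow> 'a list set" where
  "language A = (\<Union>u\<in>finals A. words_to A u)"

definition dfa :: "('q, 'a::finite) automaton \<Rightarrow> bool" where
  "dfa A \<longleftrightarrow>
    finite (states A) \<and> source A \<in> states A \<and> finals A \<subseteq> states A \<and>
    (\<forall>u\<in>states A. \<forall>a v. trans A u a = Some v \<longrightarrow> v \<in> states A) \<and>
    (\<forall>u\<in>states A. words_to A u \<noteq> {})"

definition wheeler_order :: "('q, 'a::linorder) automaton \<Rightarrow> ('q \<times> 'q) set \<Rightarrow> bool" where
  "wheeler_order A r \<longleftrightarrow>
    r \<subseteq> states A \<times> states A \<and> strict_linear_order_on (states A) r \<and>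
    (\<forall>u\<in>states A - {source A}. (source A, u) \<in> r) \<and>
    (\<forall>u\<in>states A. \<forall>v\<in>states A. \<forall>a b u' v'.
      trans A u a = Some u' \<and> trans A v b = Some v' \<and> a < b \<longrightarrow> (u', v') \<in> r) \<and>
    (\<forall>u\<in>states A. \<forall>v\<in>states A. \<forall>a u' v'.
      trans A u a = Some u' \<and> trans A v a = Some v' \<and> u' \<noteq> v' \<and> (u, v) \<in> r
        \<longrightarrow> (u', v') \<in> r)"

definition wheeler_dfa :: "('q, 'a::{finite,linorder}) automaton \<Rightarrow> bool" where
  "wheeler_dfa A \<longleftrightarrow> dfa A \<and> (\<exists>r. wheeler_order A r)"

(* HOL cannot quantify over state types inside a formula.  Taking nat as the state type
   here and in minimum_dfa loses nothing, since state sets are finite. *)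

definition wheeler_language :: "'a::{finite,linorder} list set \<Rightarrow> bool" where
  "wheeler_language L \<longleftrightarrow>
    (\<exists>A :: (nat, 'a) automaton. wheeler_dfa A \<and> language A = L)"

(* Minimality is among DFAs with partial transition functions.  So, unless L is empty, every
   state of a minimum DFA of L can reach a final state, and the minimum DFA is unique up to
   isomorphism.  If L is empty, the source is the only state. *)

definition minimum_dfa :: "('q, 'a::finite) automaton \<Rightarrow> 'a list set \<Rightarrow> bool" where
  "minimum_dfa M L \<longleftrightarrow>
    dfa M \<and> language M = L \<and>
    (\<forall>B :: (nat, 'a) automaton. dfa B \<and> language B = L \<longrightarrow> card (states M) \<le> card (states B))"

(* The square is not a dfa in general: some of its states may be unreachable. *)

definition square :: "('q, 'a) automaton \<Rightarrow> ('q \<times> 'q, 'a) automaton" where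
  "square A =
    \<lparr> states = states A \<times> states A,
      trans = (\<lambda>(u, v) a.
        case (trans A u a, trans A v a) of
          (Some u', Some v') \<Rightarrow> Some (u', v')
        | _ \<Rightarrow> None),
      source = (source A, source A),
      finals = finals A \<times> finals A \<rparr>"

definition arrow :: "('q, 'a) automaton \<Rightarrow> 'q \<Rightarrow> 'q \<Rightarrow> bool" where
  "arrow A p q \<longleftrightarrow> (\<exists>a. trans A p a = Some q)"

(* The vertices may repeat, and one vertex with a self-loop is a cycle. *)

definition cycle :: "('q, 'a) automaton \<Rightarrow> 'q list \<Rightarrow> bool" where
  "cycle A ps \<longleftrightarrow>
    ps \<noteq> [] \<and> set ps \<subseteq> states A \<and>
    (\<forall>i<length ps. arrow A (ps ! i) (ps ! (Suc i mod length ps)))"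

definition state_interval :: "('q, 'a::{finite,linorder}) automaton \<Rightarrow> 'q \<Rightarrow> 'a lstring set" where
  "state_interval A u =
    {Inf (of_word ` words_to A u) <..< Sup (of_word ` words_to A u)}"

end

theory Submission
  imports Defs
begin

text \<open>
  Let \<open>(u, v)\<close> be a vertex of the cycle, \<open>w\<close> the word labelling the cycle from there, and \<open>W\<close> the
  left-infinite string \<open>\<dots>www\<close>. A point common to the two intervals provides \<open>x\<close> in \<open>I\<^sub>u\<close> and
  \<open>y\<close> in \<open>I\<^sub>v\<close> on the same side of \<open>W\<close>. Then \<open>x\<close>, \<open>y w\<^sup>n\<close>, \<open>x w\<^sup>2\<^sup>n\<close>, \<open>y w\<^sup>3\<^sup>n\<close>, \<open>\<dots>\<close> is monotone
  for a large \<open>n\<close>. The runs of a Wheeler DFA are monotone in the word read, so its states along this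
  sequence stabilize, although \<open>u\<close> and \<open>v\<close> are not equivalent.

  Conversely, call two words with defined runs in the minimum DFA equivalent if they, and all such
  words between them, reach the same state and have the same last character. This relation is
  right-invariant and its classes are convex, so if there are finitely many classes, they are the
  states of a Wheeler DFA. If there are infinitely many, then by the pigeonhole principle there are
  words \<open>x1 < z1 < x2 < z2 < x3\<close> with a long common suffix, along which the \<open>xi\<close> have the same run and
  the \<open>zi\<close> have the same run, ending in a different state. The square automaton reading this suffix
  runs into a cycle.
\<close>

section \<open>The co-lexicographic order on words\<close>

lemma Eps_less_Snoc [simp]: "Eps < Snoc x a"
  by (simp add: less_lstring_def colex_less.Eps)

lemma not_less_Eps [simp]: "\<not> x < Eps"
  by (auto simp: less_lstring_def elim: colex_less.cases)

lemma Snoc_less_Snoc [simp]: "Snoc x a < Snoc y b \<longleftrightarrow> a < b \<or> a = b \<and> x < y"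
  by (simp add: less_lstring_def colex_less_Snoc_iff)

lemma Snoc_le_Snoc [simp]: "Snoc x a \<le> Snoc y b \<longleftrightarrow> a < b \<or> a = b \<and> x \<le> y"
  by (auto simp: le_less)

lemma of_word_Nil [simp]: "of_word [] = Eps"
  by (simp add: of_word_def)

lemma of_word_snoc [simp]: "of_word (w @ [a]) = Snoc (of_word w) a"
  by (simp add: of_word_def)

lemma of_word_append: "of_word (v @ w) = foldl Snoc (of_word v) w"
  by (simp add: of_word_def)

lemma foldl_Snoc_less_iff [simp]: "foldl Snoc x w < foldl Snoc y w \<longleftrightarrow> x < y"
  by (induction w rule: rev_induct) auto

lemma of_word_append_less_iff [simp]:
  "of_word (x @ w) < of_word (y @ w) \<longleftrightarrow> of_word x < of_word y"
  by (simp add: of_word_append)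

lemma of_word_eq_Eps_iff [simp]: "of_word w = Eps \<longleftrightarrow> w = []"
  by (cases w rule: rev_cases) auto

lemma inj_of_word: "inj of_word"
proof (rule injI)
  show "x = y" if "of_word x = of_word y" for x y :: "'a list"
    using that
  proof (induction x arbitrary: y rule: rev_induct)
    case Nil
    then show ?case by (metis of_word_Nil of_word_eq_Eps_iff)
  next
    case (snoc a x)
    then show ?case by (cases y rule: rev_cases) auto
  qed
qed

text \<open>At each last character \<open>y\<close> is squeezed between two words ending alike, so
  it ends alike too; dropping that character preserves the inequalities.\<close>

lemma common_suffix_between:
  assumes "of_word (x @ w) \<le> of_word y" and "of_word y \<le> of_word (z @ w)"
  obtains y' where "y = y' @ w"
proof -
  have "\<exists>y'. y = y' @ w" using assms
  proof (induction w arbitrary: y rule: rev_induct)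
    case (snoc a w)
    show ?case
    proof (cases y rule: rev_cases)
      case Nil
      then show ?thesis using snoc.prems
        by (auto simp flip: append_assoc simp: not_less[symmetric])
    next
      case (snoc y'' b)
      then show ?thesis using snoc.prems snoc.IH[of y'']
        by (auto simp flip: append_assoc dest: less_trans)
    qed
  qed simp
  then show thesis using that by blast
qed

section \<open>Left-infinite powers of a word and their finite suffixes\<close>

primcorec left_infinite :: "(nat \<Rightarrow> 'a) \<Rightarrow> 'a lstring" where
  "left_infinite f = Snoc (left_infinite (\<lambda>n. f (Suc n))) (f 0)"

text \<open>Positions count from the right end, hence the \<open>rev\<close>; splitting off
  \<open>w\<close> shifts them by \<open>length w\<close>.\<close>

lemma left_infinite_split:
  assumes "\<And>i. i < length w \<Longrightarrow> rev w ! i = f i"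
  shows "foldl Snoc (left_infinite (\<lambda>n. f (n + length w))) w = left_infinite f"
  using assms
proof (induction w arbitrary: f rule: rev_induct)
  case (snoc a w)
  have "foldl Snoc (left_infinite (\<lambda>n. f (Suc (n + length w)))) w = left_infinite (\<lambda>n. f (Suc n))"
    using snoc.IH[of "\<lambda>n. f (Suc n)"] snoc.prems[of "Suc i" for i] by auto
  moreover have "f 0 = a" using snoc.prems[of 0] by simp
  ultimately show ?case by (subst (2) left_infinite.ctr) simp
qed simp

text \<open>Repeating the characters of \<open>w\<close> from the right gives a function invariant
  under the shift by \<open>length w\<close>; its string is the left-infinite power of
  \<open>w\<close>.\<close>

lemma periodic_lstring:
  assumes "w \<noteq> []"
  obtains x where "foldl Snoc x w = x"
proof -
  let ?f = "\<lambda>n. rev w ! (n mod length w)"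
  have "foldl Snoc (left_infinite (\<lambda>n. ?f (n + length w))) w = left_infinite ?f"
    by (rule left_infinite_split) simp
  then show thesis using that by simp
qed

lemma foldl_Snoc_replicate:
  assumes "foldl Snoc x w = x"
  shows "foldl Snoc x (concat (replicate k w)) = x"
  by (induction k) (simp_all add: assms)

text \<open>A comparison is decided after finitely many characters from the right. The induction
  counts them: one for a base rule, one more for each \<open>init\<close>. Every string that agrees
  with \<open>z\<close> that far can replace it.\<close>

lemma less_lstring_finite_suffix:
  assumes "x < z"
  shows "\<exists>n. \<forall>u v y. z = foldl Snoc v u \<and> n \<le> length u \<longrightarrow> x < foldl Snoc y u"
  using assms unfolding less_lstring_def
proof (induction rule: colex_less.induct)
  case (Eps y b)
  show ?case
  proof (intro exI[of _ 1] allI impI)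
    fix u and v y' :: "'a lstring"
    assume "Snoc y b = foldl Snoc v u \<and> 1 \<le> length u"
    then show "colex_less Eps (foldl Snoc y' u)"
      by (cases u rule: rev_cases) (auto intro: colex_less.intros)
  qed
next
  case (last a b x y)
  show ?case
  proof (intro exI[of _ 1] allI impI)
    fix u and v y' :: "'a lstring"
    assume "Snoc y b = foldl Snoc v u \<and> 1 \<le> length u"
    then show "colex_less (Snoc x a) (foldl Snoc y' u)" using last
      by (cases u rule: rev_cases) (auto intro: colex_less.intros)
  qed
next
  case (init x y a)
  then obtain n where n: "\<And>u v y'. y = foldl Snoc v u \<Longrightarrow> n \<le> length u \<Longrightarrow> colex_less x (foldl Snoc y' u)"
    by blast
  show ?case
  proof (intro exI[of _ "Suc n"] allI impI)
    fix u and v y' :: "'a lstring"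
    assume "Snoc y a = foldl Snoc v u \<and> Suc n \<le> length u"
    then show "colex_less (Snoc x a) (foldl Snoc y' u)" using n
      by (cases u rule: rev_cases) (auto intro: colex_less.intros)
  qed
qed

lemma greater_lstring_finite_suffix:
  assumes "z < x"
  shows "\<exists>n. \<forall>u v y. z = foldl Snoc v u \<and> n \<le> length u \<longrightarrow> foldl Snoc y u < x"
  using assms unfolding less_lstring_def
proof (induction rule: colex_less.induct)
  \<comment> \<open>Vacuous: \<open>Eps\<close> has no suffix of positive length.\<close>
  case (Eps y b)
  show ?case
  proof (intro exI[of _ 1] allI impI)
    fix u and v y' :: "'a lstring"
    assume "Eps = foldl Snoc v u \<and> 1 \<le> length u"
    then show "colex_less (foldl Snoc y' u) (Snoc y b)"
      by (cases u rule: rev_cases) auto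
  qed
next
  case (last a b x y)
  show ?case
  proof (intro exI[of _ 1] allI impI)
    fix u and v y' :: "'a lstring"
    assume "Snoc x a = foldl Snoc v u \<and> 1 \<le> length u"
    then show "colex_less (foldl Snoc y' u) (Snoc y b)" using last
      by (cases u rule: rev_cases) (auto intro: colex_less.intros)
  qed
next
  case (init x y a)
  then obtain n where n: "\<And>u v y'. x = foldl Snoc v u \<Longrightarrow> n \<le> length u \<Longrightarrow> colex_less (foldl Snoc y' u) y"
    by blast
  show ?case
  proof (intro exI[of _ "Suc n"] allI impI)
    fix u and v y' :: "'a lstring"
    assume "Snoc x a = foldl Snoc v u \<and> Suc n \<le> length u"
    then show "colex_less (foldl Snoc y' u) (Snoc y a)" using n
      by (cases u rule: rev_cases) (auto intro: colex_less.intros)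
  qed
qed

lemma length_concat_replicate_ge:
  "w \<noteq> [] \<Longrightarrow> n \<le> k \<Longrightarrow> n \<le> length (concat (replicate k w))"
proof -
  assume "w \<noteq> []" "n \<le> k"
  then have "n * 1 \<le> k * length w" by (intro mult_le_mono) (auto simp: Suc_le_eq)
  then show ?thesis by (simp add: length_concat sum_list_replicate)
qed

text \<open>Every power of \<open>w\<close> is a suffix of the fixed point \<open>z\<close>, so a
  long enough one already decides the comparison, whatever precedes it.\<close>

lemma less_periodic:
  assumes "foldl Snoc z w = z" and "w \<noteq> []" and "of_word x < z"
  shows "\<exists>n. \<forall>k\<ge>n. \<forall>y. of_word x < of_word (y @ concat (replicate k w))"
proof -
  obtain n where n: "\<And>u v y. z = foldl Snoc v u \<Longrightarrow> n \<le> length u \<Longrightarrow> of_word x < foldl Snoc y u"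
    using less_lstring_finite_suffix[OF assms(3)] by blast
  have "of_word x < of_word (y @ concat (replicate k w))" if "n \<le> k" for k y
    unfolding of_word_append
    by (rule n[OF foldl_Snoc_replicate[OF assms(1), symmetric]
          length_concat_replicate_ge[OF assms(2) that]])
  then show ?thesis by blast
qed

lemma greater_periodic:
  assumes "foldl Snoc z w = z" and "w \<noteq> []" and "z < of_word x"
  shows "\<exists>n. \<forall>k\<ge>n. \<forall>y. of_word (y @ concat (replicate k w)) < of_word x"
proof -
  obtain n where n: "\<And>u v y. z = foldl Snoc v u \<Longrightarrow> n \<le> length u \<Longrightarrow> foldl Snoc y u < of_word x"
    using greater_lstring_finite_suffix[OF assms(3)] by blast
  have "of_word (y @ concat (replicate k w)) < of_word x" if "n \<le> k" for k y
    unfolding of_word_append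
    by (rule n[OF foldl_Snoc_replicate[OF assms(1), symmetric]
          length_concat_replicate_ge[OF assms(2) that]])
  then show ?thesis by blast
qed

section \<open>Runs and quotient automata\<close>

lemma run_append: "run A u (v @ w) = Option.bind (run A u v) (\<lambda>q. run A q w)"
  by (induction v arbitrary: u) (auto split: bind_splits)

lemma run_snoc: "run A u (w @ [a]) = Option.bind (run A u w) (\<lambda>q. trans A q a)"
  by (simp add: run_append split: bind_splits)

lemma run_in_states:
  assumes "dfa A" and "u \<in> states A" and "run A u w = Some v"
  shows "v \<in> states A"
  using assms(2,3)
proof (induction w arbitrary: u)
  case (Cons a w)
  then obtain q where q: "trans A u a = Some q" "run A q w = Some v"
    by (auto split: bind_splits)
  then have "q \<in> states A" using assms(1) Cons.prems(1) unfolding dfa_def by blast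
  then show ?case using Cons.IH q by blast
qed simp

lemma run_source_in_states:
  "dfa A \<Longrightarrow> run A (source A) w = Some v \<Longrightarrow> v \<in> states A"
  using run_in_states[of A "source A" w v] by (simp add: dfa_def)

lemma mem_language_iff: "w \<in> language A \<longleftrightarrow> (\<exists>q\<in>finals A. run A (source A) w = Some q)"
  by (auto simp: language_def words_to_def)

lemma run_square:
  "run (square A) (u, v) w = Some (u', v') \<longleftrightarrow> run A u w = Some u' \<and> run A v w = Some v'"
proof (induction w arbitrary: u v)
  case (Cons a w)
  then show ?case
    by (cases "trans A u a"; cases "trans A v a") (auto simp: square_def)
qed auto

lemma cycle_run:
  assumes "cycle A ps" and "i \<le> length ps"
  shows "\<exists>w. length w = i \<and> run A (ps ! 0) w = Some (ps ! (i mod length ps))"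
  using assms(2)
proof (induction i)
  case (Suc i)
  then obtain w where w: "length w = i" "run A (ps ! 0) w = Some (ps ! i)"
    by auto
  obtain a where "trans A (ps ! i) a = Some (ps ! (Suc i mod length ps))"
    using assms(1) Suc.prems by (auto simp: cycle_def arrow_def Suc_le_eq)
  then show ?case using w by (intro exI[of _ "w @ [a]"]) (simp add: run_snoc)
qed simp

text \<open>The states are the values of \<open>f\<close>, which names the classes of a right-invariant relation on
  the prefix-closed set \<open>P\<close> of words with a defined run.\<close>

definition quotient_automaton ::
  "'a list set \<Rightarrow> ('a list \<Rightarrow> 'q) \<Rightarrow> 'a list set \<Rightarrow> ('q, 'a) automaton" where
  "quotient_automaton P f L =
    \<lparr> states = f ` P,
      trans = (\<lambda>q a. if \<exists>w\<in>P. f w = q \<and> w @ [a] \<in> P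
        then Some (f ((SOME w. w \<in> P \<and> f w = q \<and> w @ [a] \<in> P) @ [a])) else None),
      source = f [],
      finals = f ` L \<rparr>"

text \<open>\<open>step_mem\<close> and \<open>step_eq\<close> make a transition independent of the
  representative that \<open>SOME\<close> picks; \<open>saturated\<close> makes \<open>L\<close> a
  union of classes, so the final states accept no other words.\<close>

locale right_invariant =
  fixes P :: "'a::finite list set" and f :: "'a list \<Rightarrow> 'q" and L :: "'a list set"
  assumes Nil: "[] \<in> P"
    and prefix: "w @ [a] \<in> P \<Longrightarrow> w \<in> P"
    and finite_range: "finite (f ` P)"
    and language_subset: "L \<subseteq> P"
    and step_mem: "w \<in> P \<Longrightarrow> w' \<in> P \<Longrightarrow> f w = f w' \<Longrightarrow> w @ [a] \<in> P \<Longrightarrow> w' @ [a] \<in> P"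
    and step_eq: "w \<in> P \<Longrightarrow> w' \<in> P \<Longrightarrow> f w = f w' \<Longrightarrow> w @ [a] \<in> P \<Longrightarrow> f (w @ [a]) = f (w' @ [a])"
    and saturated: "w \<in> P \<Longrightarrow> w' \<in> L \<Longrightarrow> f w = f w' \<Longrightarrow> w \<in> L"
begin

abbreviation "A \<equiv> quotient_automaton P f L"

lemma trans_quotient:
  assumes "w \<in> P"
  shows "trans A (f w) a = (if w @ [a] \<in> P then Some (f (w @ [a])) else None)"
proof -
  let ?Q = "\<lambda>v. v \<in> P \<and> f v = f w \<and> v @ [a] \<in> P"
  show ?thesis
  proof (cases "\<exists>v. ?Q v")
    case True
    then have Q: "?Q (SOME v. ?Q v)" by (rule someI_ex)
    then have "f ((SOME v. ?Q v) @ [a]) = f (w @ [a])" "w @ [a] \<in> P"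
      using step_eq[of "SOME v. ?Q v" w a] step_mem[of "SOME v. ?Q v" w a] assms by auto
    then show ?thesis using True by (auto simp: quotient_automaton_def)
  next
    case False
    then show ?thesis using assms by (auto simp: quotient_automaton_def)
  qed
qed

lemma run_quotient: "run A (source A) w = (if w \<in> P then Some (f w) else None)"
proof (induction w rule: rev_induct)
  case Nil
  then show ?case using right_invariant.Nil[OF right_invariant_axioms]
    by (simp add: quotient_automaton_def)
next
  case (snoc a w)
  then show ?case using prefix[of w a] trans_quotient[of w a]
    by (auto simp: run_snoc)
qed

lemma states_quotient: "states A = f ` P"
  by (simp add: quotient_automaton_def)

lemma source_quotient: "source A = f []"
  by (simp add: quotient_automaton_def)

lemma dfa_quotient: "dfa A"
  unfolding dfa_def
proof (intro conjI ballI allI impI)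
  show "finite (states A)" using finite_range by (simp add: states_quotient)
  show "source A \<in> states A" using Nil by (simp add: states_quotient source_quotient)
  show "finals A \<subseteq> states A" using language_subset by (auto simp: quotient_automaton_def)
  show "v \<in> states A" if "u \<in> states A" "trans A u a = Some v" for u a v
    using that trans_quotient by (auto simp: states_quotient split: if_splits)
  show "words_to A u \<noteq> {}" if "u \<in> states A" for u
    using that run_quotient by (auto simp: states_quotient words_to_def)
qed

lemma language_quotient: "language A = L"
proof -
  have "finals A = f ` L" by (simp add: quotient_automaton_def)
  then show ?thesis using run_quotient saturated language_subset
    by (auto simp: mem_language_iff split: if_splits)
qed

end

section \<open>Right languages of the states of a minimum DFA\<close>

definition right_language :: "('q, 'a) automaton \<Rightarrow> 'q \<Rightarrow> 'a list set" where
  "right_language A u = {w. \<exists>q\<in>finals A. run A u w = Some q}"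

text \<open>Right languages of reached states are residuals of the language. These do not depend on
  the automaton, which allows states of different automata to be compared.\<close>

lemma right_language_run:
  assumes "run A (source A) w = Some u"
  shows "right_language A u = {z. w @ z \<in> language A}"
  using assms by (auto simp: right_language_def mem_language_iff run_append)

text \<open>Myhill-Nerode: the nonempty residuals of \<open>L\<close> are the states of a DFA for
  \<open>L\<close>. The residual of \<open>[]\<close> is kept even if empty, because a DFA always
  has its source.\<close>

lemma minimum_dfa_card_le:
  fixes M :: "('q, 'a::finite) automaton"
  assumes "minimum_dfa M L"
  defines "N \<equiv> \<lambda>w. {z. w @ z \<in> L}"
  shows "card (states M) \<le> card (N ` {w. w = [] \<or> N w \<noteq> {}})"
    and "N ` {w. w = [] \<or> N w \<noteq> {}} \<subseteq> right_language M ` states M"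
proof -
  have M: "dfa M" and L: "language M = L"
    using assms(1) by (auto simp: minimum_dfa_def)
  define P where "P = {w. w = [] \<or> N w \<noteq> {}}"
  have reach: "N w \<in> right_language M ` states M" if "w \<in> P" for w
  proof -
    have "run M (source M) w \<noteq> None"
    proof
      assume "run M (source M) w = None"
      moreover from this have "w \<noteq> []" by auto
      ultimately show False using that L
        by (auto simp: P_def N_def mem_language_iff run_append)
    qed
    then obtain u where u: "run M (source M) w = Some u" by auto
    then show ?thesis using right_language_run[OF u] run_source_in_states[OF M u] L
      by (auto simp: N_def)
  qed
  then show sub: "N ` {w. w = [] \<or> N w \<noteq> {}} \<subseteq> right_language M ` states M"
    by (auto simp: P_def)
  have fin: "finite (N ` P)"
    using sub M finite_subset unfolding P_def dfa_def by (meson finite_imageI)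
  \<comment> \<open>\<open>minimum_dfa\<close> compares with automata over \<open>nat\<close>, so
    the residuals are encoded as numbers.\<close>
  then obtain g :: "'a list set \<Rightarrow> nat" where g: "inj_on g (N ` P)"
    using finite_imp_inj_to_nat_seg by metis
  have Nstep: "N (w @ [a]) = {z. a # z \<in> N w}" for w a by (auto simp: N_def)
  interpret right_invariant P "\<lambda>w. g (N w)" L
  proof
    show "[] \<in> P" by (simp add: P_def)
    show "w \<in> P" if "w @ [a] \<in> P" for w a
      using that by (auto simp: P_def Nstep)
    show "finite ((\<lambda>w. g (N w)) ` P)"
      using fin by (simp add: image_image[symmetric])
    show "L \<subseteq> P"
    proof
      fix w assume "w \<in> L"
      then have "[] \<in> N w" by (simp add: N_def)
      then show "w \<in> P" by (auto simp: P_def)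
    qed
    fix w w' a
    have eq: "N w = N w'" if "w \<in> P" "w' \<in> P" "g (N w) = g (N w')" for w w'
      using g that by (auto dest: inj_onD)
    show "w' @ [a] \<in> P" if "w \<in> P" "w' \<in> P" "g (N w) = g (N w')" "w @ [a] \<in> P"
      using eq that by (auto simp: P_def Nstep)
    show "g (N (w @ [a])) = g (N (w' @ [a]))" if "w \<in> P" "w' \<in> P" "g (N w) = g (N w')"
      using eq[OF that] by (simp add: Nstep)
    show "w \<in> L" if "w \<in> P" "w' \<in> L" "g (N w) = g (N w')"
    proof -
      have "w' \<in> P" using \<open>L \<subseteq> P\<close> that by auto
      then have "N w = N w'" using eq that by auto
      moreover have "[] \<in> N w'" using that by (simp add: N_def)
      ultimately have "[] \<in> N w" by blast
      then show ?thesis by (simp add: N_def)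
    qed
  qed
  have "card (states M) \<le> card (states A)"
    using assms(1) dfa_quotient language_quotient unfolding minimum_dfa_def by blast
  also have "states A = g ` N ` P" by (simp add: states_quotient image_image)
  also have "card \<dots> = card (N ` P)" using g by (rule card_image)
  finally show "card (states M) \<le> card (N ` {w. w = [] \<or> N w \<noteq> {}})"
    by (simp add: P_def)
qed

text \<open>States, residuals and right languages are squeezed to the same number, so
  \<open>?R\<close> is injective and its values are exactly the residuals. A second state is
  essential for nonemptiness: the one-state DFA of the empty language has an empty right
  language.\<close>

lemma minimum_dfa_right_languages:
  fixes M :: "('q, 'a::finite) automaton"
  assumes min: "minimum_dfa M L" and uv: "u \<in> states M" "v \<in> states M" "u \<noteq> v"
  shows "right_language M u \<noteq> right_language M v" and "right_language M u \<noteq> {}"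
proof -
  let ?N = "\<lambda>w. {z. w @ z \<in> L}" and ?R = "right_language M"
  let ?B = "?N ` {w. w = [] \<or> ?N w \<noteq> {}}"
  have M: "dfa M" and L: "language M = L" using min by (auto simp: minimum_dfa_def)
  note card = minimum_dfa_card_le[OF min]
  have fin: "finite (states M)" using M by (simp add: dfa_def)
  have "card ?B \<le> card (?R ` states M)" "card (?R ` states M) \<le> card (states M)"
    using card_mono[OF finite_imageI[OF fin] card(2)] card_image_le[OF fin] by auto
  then have "card (?R ` states M) = card (states M)" "card ?B = card (?R ` states M)"
    using card(1) by linarith+
  then have inj: "inj_on ?R (states M)" and B: "?B = ?R ` states M"
    using eq_card_imp_inj_on[OF fin] card_subset_eq[OF finite_imageI[OF fin] card(2)] by blast+
  show ne: "?R u \<noteq> ?R v" using inj uv by (auto dest: inj_onD)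
  show "?R u \<noteq> {}"
  proof
    assume u: "?R u = {}"
    \<comment> \<open>The only member of \<open>?B\<close> that can be empty is the residual of
      \<open>[]\<close>, which is \<open>L\<close> itself.\<close>
    have "?R u \<in> ?B" using B uv by blast
    then have "L = {}" using u by auto
    moreover obtain w where "run M (source M) w = Some v"
      using M uv by (auto simp: dfa_def words_to_def)
    ultimately have "?R v = {}" using right_language_run[of M w v] L by simp
    then show False using ne u by simp
  qed
qed

section \<open>Entangled cycles exclude Wheeler languages\<close>

text \<open>Induction from the right: different last characters are settled by the second Wheeler
  axiom, equal ones by the third applied to the preceding states; the empty word leads to the least
  state.\<close>

lemma wheeler_order_run_mono:
  assumes A: "dfa A" and r: "wheeler_order A r"
    and "run A (source A) x = Some p" and "run A (source A) y = Some q"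
    and "of_word x < of_word y"
  shows "p = q \<or> (p, q) \<in> r"
  using assms(3-)
proof (induction x arbitrary: y p q rule: rev_induct)
  case Nil
  then have "q \<in> states A" using run_source_in_states[OF A] by blast
  then show ?case using Nil r by (auto simp: wheeler_order_def)
next
  case (snoc a x)
  obtain y' b where y: "y = y' @ [b]"
    using snoc.prems by (cases y rule: rev_cases) auto
  obtain p' q' where p': "run A (source A) x = Some p'" "trans A p' a = Some p"
    and q': "run A (source A) y' = Some q'" "trans A q' b = Some q"
    using snoc.prems y by (auto simp: run_snoc split: bind_splits)
  have states: "p' \<in> states A" "q' \<in> states A"
    using run_source_in_states[OF A] p' q' by blast+
  consider "a < b" | "a = b" "of_word x < of_word y'"
    using snoc.prems(3) y by auto
  then show ?case
  proof cases
    case 1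
    then show ?thesis using r states p' q' unfolding wheeler_order_def by blast
  next
    case 2
    then have "p' = q' \<or> (p', q') \<in> r" using snoc.IH p' q' by blast
    then show ?thesis
    proof
      assume "p' = q'"
      then show ?thesis using p' q' 2(1) by simp
    next
      assume "(p', q') \<in> r"
      then show ?thesis using r states p'(2) q'(2) 2(1) unfolding wheeler_order_def by blast
    qed
  qed
qed

text \<open>Otherwise the chain would be strict, hence injective on the natural numbers.\<close>

lemma finite_chain_stabilizes:
  assumes "finite S" and "\<And>i::nat. q i \<in> S" and "Relation.trans r" and "irrefl r"
    and step: "\<And>i. q i = q (Suc i) \<or> (q i, q (Suc i)) \<in> r"
  shows "\<exists>i. q i = q (Suc i)"
proof (rule ccontr)
  assume "\<nexists>i. q i = q (Suc i)"
  then have step': "(q i, q (Suc i)) \<in> r" for i using step by blast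
  have less: "(q i, q j) \<in> r" if "i < j" for i j
    using that by (induction rule: less_Suc_induct) (auto intro: step' transD[OF assms(3)])
  have "inj q"
    using less assms(4) by (intro linorder_injI) (metis irreflD)
  moreover have "finite (range q)" using assms(1,2) by (meson finite_subset image_subsetI)
  ultimately show False using finite_imageD by auto
qed

lemma run_replicate:
  "run A u w = Some u \<Longrightarrow> run A u (concat (replicate k w)) = Some u"
  by (induction k) (simp_all add: run_append)

text \<open>The hypotheses on \<open>x\<close> and \<open>y\<close> say that both lie on the same side of the left-infinite power of
  \<open>w\<close>: then the words \<open>x w\<^sup>i\<close> and \<open>y w\<^sup>j\<close> interleave.\<close>

lemma wheeler_interleaving_eq:
  assumes A: "dfa A" and r: "wheeler_order A r"
    and run: "\<And>k. run A (source A) (x @ concat (replicate k w)) \<noteq> None"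
      "\<And>k. run A (source A) (y @ concat (replicate k w)) \<noteq> None"
    and side: "(of_word x < of_word (y @ concat (replicate n w)) \<and>
        of_word y < of_word (x @ concat (replicate n w))) \<or>
      (of_word (y @ concat (replicate n w)) < of_word x \<and>
        of_word (x @ concat (replicate n w)) < of_word y)"
  shows "\<exists>i j. run A (source A) (x @ concat (replicate i w)) =
    run A (source A) (y @ concat (replicate j w))"
proof -
  \<comment> \<open>The words alternate between \<open>x\<close> and \<open>y\<close>. Both
    \<open>z i\<close> and \<open>z (Suc i)\<close> end in \<open>i * n\<close> copies of
    \<open>w\<close>; without these, their comparison is one of those in
    \<open>side\<close>.\<close>
  define z where "z i = (if even i then x else y) @ concat (replicate (i * n) w)" for i
  define q where "q i = the (run A (source A) (z i))" for i
  have q: "run A (source A) (z i) = Some (q i)" for i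
    using run by (auto simp: q_def z_def)
  have z_Suc: "z (Suc i) = ((if even i then y else x) @ concat (replicate n w)) @
      concat (replicate (i * n) w)" for i
    by (simp add: z_def replicate_add)
  have states: "q i \<in> states A" for i
    using run_source_in_states[OF A q] .
  have fin: "finite (states A)" using A by (simp add: dfa_def)
  have trans: "Relation.trans r" and irrefl: "irrefl r"
    using r by (auto simp: wheeler_order_def strict_linear_order_on_def)
  have "\<exists>i. q i = q (Suc i)"
    using side
  proof
    assume s: "of_word x < of_word (y @ concat (replicate n w)) \<and>
        of_word y < of_word (x @ concat (replicate n w))"
    have "of_word (z i) < of_word (z (Suc i))" for i
      unfolding z_Suc unfolding z_def of_word_append_less_iff using s by auto
    then show ?thesis
      using finite_chain_stabilizes[OF fin states trans irrefl] wheeler_order_run_mono[OF A r q q]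
      by blast
  next
    assume s: "of_word (y @ concat (replicate n w)) < of_word x \<and>
        of_word (x @ concat (replicate n w)) < of_word y"
    have "of_word (z (Suc i)) < of_word (z i)" for i
      unfolding z_Suc unfolding z_def of_word_append_less_iff using s by auto
    \<comment> \<open>The words descend here, so the states form a chain for the converse
      order.\<close>
    then have "q i = q (Suc i) \<or> (q i, q (Suc i)) \<in> r\<inverse>" for i
      using wheeler_order_run_mono[OF A r q q, of "Suc i" i] by auto
    moreover have "Relation.trans (r\<inverse>)" "irrefl (r\<inverse>)"
      using trans irrefl by (auto simp: irrefl_def)
    ultimately show ?thesis
      using finite_chain_stabilizes[OF fin states] by blast
  qed
  then obtain i where eq: "run A (source A) (z i) = run A (source A) (z (Suc i))"
    using q by metis
  show ?thesis
  proof (cases "even i")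
    case True
    then show ?thesis using eq unfolding z_def by (auto simp del: mult_Suc)
  next
    case False
    then show ?thesis using eq[symmetric] unfolding z_def by (auto simp del: mult_Suc)
  qed
qed

lemma entangled_cycle_not_wheeler:
  fixes M :: "('r, 'a::{finite,linorder}) automaton"
  assumes min: "minimum_dfa M L" and uv: "u \<in> states M" "v \<in> states M" "u \<noteq> v"
    and w: "w \<noteq> []" "run M u w = Some u" "run M v w = Some v"
    and int: "state_interval M u \<inter> state_interval M v \<noteq> {}"
  shows "\<not> wheeler_language L"
proof
  assume "wheeler_language L"
  then obtain A :: "(nat, 'a) automaton" and r
    where A: "dfa A" "wheeler_order A r" "language A = L"
    by (auto simp: wheeler_language_def wheeler_dfa_def)
  have M: "language M = L" using min by (simp add: minimum_dfa_def)
  have pump: "run M (source M) (x @ concat (replicate k w)) = Some p"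
    if "x \<in> words_to M p" "run M p w = Some p" for x p k
    using that run_replicate by (simp add: words_to_def run_append)
  \<comment> \<open>A word leading to \<open>u\<close> or \<open>v\<close> extends to a word of
    \<open>L\<close>, so \<open>A\<close> must be able to read it.\<close>
  have runA: "run A (source A) x \<noteq> None" if p: "run M (source M) x = Some p" "p = u \<or> p = v" for x p
  proof -
    have "right_language M p \<noteq> {}"
      using minimum_dfa_right_languages(2)[OF min] uv p(2) by metis
    then obtain z where "x @ z \<in> language A"
      using right_language_run[OF p(1)] A(3) M by auto
    then show ?thesis by (auto simp: mem_language_iff run_append split: bind_splits)
  qed
  \<comment> \<open>Interleaving would lead a word for \<open>u\<close> and a word for
    \<open>v\<close> to the same state of \<open>A\<close>. Then their residuals agree, and so do
    the right languages of \<open>u\<close> and \<open>v\<close>.\<close>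
  have apart: False
    if x: "x \<in> words_to M u" and y: "y \<in> words_to M v"
      and side: "(of_word x < of_word (y @ concat (replicate n w)) \<and>
        of_word y < of_word (x @ concat (replicate n w))) \<or>
      (of_word (y @ concat (replicate n w)) < of_word x \<and>
        of_word (x @ concat (replicate n w)) < of_word y)"
    for x y n
  proof -
    note px = pump[OF x w(2)] and py = pump[OF y w(3)]
    obtain i j where eq: "run A (source A) (x @ concat (replicate i w)) =
        run A (source A) (y @ concat (replicate j w))"
      using wheeler_interleaving_eq[OF A(1,2) _ _ side] runA px py by blast
    then obtain q where
      "run A (source A) (x @ concat (replicate i w)) = Some q"
      "run A (source A) (y @ concat (replicate j w)) = Some q"
      using runA[OF px] by fastforce
    then have "right_language M u = right_language M v"
      using right_language_run px py A(3) M by metis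
    then show False using minimum_dfa_right_languages(1)[OF min uv] by simp
  qed
  obtain g where g: "g \<in> state_interval M u" "g \<in> state_interval M v" using int by blast
  obtain x x' y y' where
    x: "x \<in> words_to M u" "of_word x < g" and x': "x' \<in> words_to M u" "g < of_word x'" and
    y: "y \<in> words_to M v" "of_word y < g" and y': "y' \<in> words_to M v" "g < of_word y'"
    using g unfolding state_interval_def
    by (auto simp: Inf_less_iff less_Sup_iff)
  obtain z where z: "foldl Snoc z w = z" using periodic_lstring[OF w(1)] .
  show False
  \<comment> \<open>If \<open>g\<close> is at most the power \<open>z\<close>, the words below
    \<open>g\<close> are below \<open>z\<close>; otherwise the words above \<open>g\<close> are
    above \<open>z\<close>. Either way there are two words on the same side.\<close>
  proof (cases "g \<le> z")
    case True
    then have "of_word x < z" "of_word y < z" using x y by auto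
    then obtain n m where
      "\<And>k s. n \<le> k \<Longrightarrow> of_word x < of_word (s @ concat (replicate k w))"
      "\<And>k s. m \<le> k \<Longrightarrow> of_word y < of_word (s @ concat (replicate k w))"
      using less_periodic[OF z w(1)] by metis
    then show False using apart[OF x(1) y(1), of "max n m"] by auto
  next
    case False
    then have "z < of_word x'" "z < of_word y'" using x' y' by auto
    then obtain n m where
      "\<And>k s. n \<le> k \<Longrightarrow> of_word (s @ concat (replicate k w)) < of_word x'"
      "\<And>k s. m \<le> k \<Longrightarrow> of_word (s @ concat (replicate k w)) < of_word y'"
      using greater_periodic[OF z w(1)] by metis
    then show False using apart[OF x'(1) y'(1), of "max n m"] by auto
  qed
qed

section \<open>Convex classes of a labelled linear order\<close>

text \<open>For \<open>k\<close> injective on \<open>P\<close>, the classes are the maximal convex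
  pieces of constant label; \<open>min\<close> and \<open>max\<close> make the definition
  symmetric.\<close>

definition convex_rel :: "('b \<Rightarrow> 'x::linorder) \<Rightarrow> ('b \<Rightarrow> 'c) \<Rightarrow> 'b set \<Rightarrow> ('b \<times> 'b) set" where
  "convex_rel k l P = {(x, y). x \<in> P \<and> y \<in> P \<and>
    (\<forall>z\<in>P. min (k x) (k y) \<le> k z \<and> k z \<le> max (k x) (k y) \<longrightarrow> l z = l x)}"

lemma convex_relI:
  assumes "x \<in> P" and "y \<in> P"
    and "\<And>z. z \<in> P \<Longrightarrow> min (k x) (k y) \<le> k z \<Longrightarrow> k z \<le> max (k x) (k y) \<Longrightarrow> l z = l x"
  shows "(x, y) \<in> convex_rel k l P"
  unfolding convex_rel_def using assms by blast

lemma convex_relD: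
  assumes "(x, y) \<in> convex_rel k l P" and "z \<in> P"
    and "min (k x) (k y) \<le> k z" and "k z \<le> max (k x) (k y)"
  shows "l z = l x"
  using assms unfolding convex_rel_def by blast

lemma convex_rel_mem: "(x, y) \<in> convex_rel k l P \<Longrightarrow> x \<in> P \<and> y \<in> P"
  unfolding convex_rel_def by blast

lemma convex_rel_label:
  assumes "(x, y) \<in> convex_rel k l P"
  shows "l x = l y"
  using convex_relD[OF assms, of y] convex_rel_mem[OF assms] by simp

text \<open>Injectivity gives reflexivity: only \<open>x\<close> has the key \<open>k x\<close>. For
  transitivity, a point between \<open>x\<close> and \<open>z\<close> lies between \<open>x\<close>
  and \<open>y\<close> or between \<open>y\<close> and \<open>z\<close>, wherever \<open>y\<close>
  is.\<close>

lemma equiv_convex_rel: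
  assumes "inj_on k P"
  shows "equiv P (convex_rel k l P)"
proof (rule equivI)
  show "convex_rel k l P \<subseteq> P \<times> P" using convex_rel_mem by fast
  show "refl_on P (convex_rel k l P)"
  proof (rule refl_onI)
    fix x assume x: "x \<in> P"
    show "(x, x) \<in> convex_rel k l P"
    proof (rule convex_relI[OF x x])
      fix z assume z: "z \<in> P" "min (k x) (k x) \<le> k z" "k z \<le> max (k x) (k x)"
      then have "k z = k x" by simp
      then show "l z = l x" using inj_onD[OF assms _ z(1) x] by simp
    qed
  qed
  show "sym (convex_rel k l P)"
  proof (rule symI)
    fix x y assume xy: "(x, y) \<in> convex_rel k l P"
    show "(y, x) \<in> convex_rel k l P"
    proof (rule convex_relI)
      show "y \<in> P" "x \<in> P" using convex_rel_mem[OF xy] by auto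
      show "l z = l y" if "z \<in> P" "min (k y) (k x) \<le> k z" "k z \<le> max (k y) (k x)" for z
        using convex_relD[OF xy that(1)] that(2,3) convex_rel_label[OF xy]
        unfolding min.commute[of "k y"] max.commute[of "k y"] by metis
    qed
  qed
  show "Relation.trans (convex_rel k l P)"
  proof (rule transI)
    fix x y z assume xy: "(x, y) \<in> convex_rel k l P" and yz: "(y, z) \<in> convex_rel k l P"
    have between: "l t = l x" if "t \<in> P" "min (k x) (k z) \<le> k t" "k t \<le> max (k x) (k z)" for t
    proof -
      have "min (k x) (k y) \<le> k t \<and> k t \<le> max (k x) (k y) \<or>
          min (k y) (k z) \<le> k t \<and> k t \<le> max (k y) (k z)"
        using that(2,3) linear[of "k t" "k y"] unfolding min_le_iff_disj le_max_iff_disj by blast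
      then have "l t = l x \<or> l t = l y"
        using convex_relD[OF xy that(1)] convex_relD[OF yz that(1)] by blast
      then show ?thesis using convex_rel_label[OF xy] by metis
    qed
    have "x \<in> P" "z \<in> P" using convex_rel_mem[OF xy] convex_rel_mem[OF yz] by auto
    then show "(x, z) \<in> convex_rel k l P" by (rule convex_relI) (rule between)
  qed
qed

lemma convex_rel_between:
  assumes "(x, z) \<in> convex_rel k l P" and "y \<in> P" and "k x \<le> k y" and "k y \<le> k z"
  shows "(x, y) \<in> convex_rel k l P"
proof (rule convex_relI)
  show "x \<in> P" "y \<in> P" using convex_rel_mem[OF assms(1)] assms(2) by auto
  fix t assume t: "t \<in> P" "min (k x) (k y) \<le> k t" "k t \<le> max (k x) (k y)"
  have "k x \<le> k t" using t(2) assms(3) by simp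
  moreover have "k t \<le> k y" using t(3) assms(3) by (simp add: max_absorb2)
  then have "k t \<le> k z" using assms(4) by simp
  ultimately show "l t = l x"
    by (intro convex_relD[OF assms(1) t(1)]) (simp_all add: min_le_iff_disj le_max_iff_disj)
qed

text \<open>Numbers the classes in increasing order. The numbers will be the states of the Wheeler
  DFA.\<close>

lemma convex_rel_rank:
  fixes k :: "'b \<Rightarrow> 'x::linorder"
  assumes inj: "inj_on k P" and fin: "finite (P // convex_rel k l P)"
  obtains f :: "'b \<Rightarrow> nat" where "finite (f ` P)"
    and "\<And>x y. x \<in> P \<Longrightarrow> y \<in> P \<Longrightarrow> k x \<le> k y \<Longrightarrow> f x \<le> f y"
    and "\<And>x y. x \<in> P \<Longrightarrow> y \<in> P \<Longrightarrow> f x = f y \<longleftrightarrow> (x, y) \<in> convex_rel k l P"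
proof -
  let ?R = "convex_rel k l P"
  note eq = equiv_convex_rel[OF inj, of l]
  have sym: "(x, y) \<in> ?R \<Longrightarrow> (y, x) \<in> ?R" for x y using eq by (meson equivE symD)
  have tr: "(x, y) \<in> ?R \<Longrightarrow> (y, z) \<in> ?R \<Longrightarrow> (x, z) \<in> ?R" for x y z using eq by (meson equivE transD)
  \<comment> \<open>The rank of \<open>x\<close> will be the number of classes lying strictly below its own.\<close>
  define B where "B x = {C \<in> P // ?R. \<exists>y\<in>C. k y < k x \<and> (y, x) \<notin> ?R}" for x
  have finB: "finite (B x)" for x using fin by (simp add: B_def)
  have mem: "y \<in> P" if "C \<in> P // ?R" "y \<in> C" for C y
    using that eq in_quotient_imp_subset by fastforce
  have mono: "B x \<subseteq> B y" if "x \<in> P" "y \<in> P" "k x \<le> k y" for x y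
  proof
    fix C assume "C \<in> B x"
    then obtain z where z: "C \<in> P // ?R" "z \<in> C" "k z < k x" "(z, x) \<notin> ?R" by (auto simp: B_def)
    then have "(z, y) \<notin> ?R" 
      using convex_rel_between[of z y k l P x] less_imp_le[OF z(3)] that(1,3) z(4) by blast
    then show "C \<in> B y" using z that by (force simp: B_def)
  qed
  \<comment> \<open>An element below \<open>x\<close> but not below \<open>y\<close> would lie
    between two related elements, and convexity would put it into their class.\<close>
  have same: "B x \<subseteq> B y" if "(x, y) \<in> ?R" for x y
  proof
    fix C assume "C \<in> B x"
    then obtain z where z: "C \<in> P // ?R" "z \<in> C" "k z < k x" "(z, x) \<notin> ?R" by (auto simp: B_def)
    have P: "z \<in> P" "x \<in> P" "y \<in> P" using mem z convex_rel_mem[OF that] by blast+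
    have nzy: "(z, y) \<notin> ?R" using z that sym tr by blast
    have "k z < k y"
    proof (rule ccontr)
      assume "\<not> k z < k y"
      then show False
        using convex_rel_between[of y x k l P z] less_imp_le[OF z(3)] sym that P(1) nzy
        unfolding not_less by blast
    qed
    then show "C \<in> B y" using z nzy by (auto simp: B_def)
  qed
  have strict: "B x \<subset> B y" if "x \<in> P" "y \<in> P" "k x < k y" "(x, y) \<notin> ?R" for x y
  proof -
    \<comment> \<open>The class of \<open>x\<close> is counted for \<open>y\<close> but never for
      \<open>x\<close>, so the inclusion is proper.\<close>
    let ?C = "?R `` {x}"
    have "?C \<in> P // ?R" using that by (auto intro: quotientI)
    moreover have "x \<in> ?C" using equiv_class_self[OF eq that(1)] .
    ultimately have "?C \<in> B y" using that by (auto simp: B_def)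
    moreover have "?C \<notin> B x" using sym by (auto simp: B_def)
    ultimately show ?thesis using mono[OF that(1,2) less_imp_le[OF that(3)]] by blast
  qed
  show thesis
  proof (rule that[of "\<lambda>x. card (B x)"])
    show "finite ((\<lambda>x. card (B x)) ` P)"
    proof (rule finite_subset)
      show "(\<lambda>x. card (B x)) ` P \<subseteq> {..card (P // ?R)}"
        using fin by (auto simp: B_def intro!: card_mono)
    qed simp
    show "card (B x) \<le> card (B y)" if "x \<in> P" "y \<in> P" "k x \<le> k y" for x y
      using mono[OF that] finB by (rule card_mono[rotated])
    show "card (B x) = card (B y) \<longleftrightarrow> (x, y) \<in> ?R" if "x \<in> P" "y \<in> P" for x y
    proof
      assume "(x, y) \<in> ?R"
      then have "B x = B y" using same sym by blast
      then show "card (B x) = card (B y)" by simp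
    next
      assume c: "card (B x) = card (B y)"
      show "(x, y) \<in> ?R"
      proof (rule ccontr)
        assume n: "(x, y) \<notin> ?R"
        have "x \<noteq> y" using n eq that by (metis equivE refl_onD)
        then have "k x < k y \<or> k y < k x" using inj_onD[OF inj] that by (meson neq_iff)
        then have "B x \<subset> B y \<or> B y \<subset> B x" using strict[of x y] strict[of y x] that n sym by blast
        then show False using c finB psubset_card_mono by (metis less_irrefl)
      qed
    qed
  qed
qed

text \<open>If \<open>h\<close> takes \<open>N\<close> values on \<open>Z\<close>, choose
  \<open>N + 2\<close> points of \<open>Y\<close>. Among points of \<open>Z\<close> in their
  \<open>N + 1\<close> gaps, two have equal \<open>h\<close>. If these are in gaps
  \<open>i < j\<close>, then \<open>x (Suc i)\<close> separates them, and \<open>x i\<close> and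
  \<open>x (Suc j)\<close> enclose them.\<close>

lemma infinite_interleaving:
  fixes k :: "'b \<Rightarrow> 'x::linorder"
  assumes inf: "infinite Y" and inj: "inj_on k Y"
    and sep: "\<And>x y. x \<in> Y \<Longrightarrow> y \<in> Y \<Longrightarrow> k x < k y \<Longrightarrow> \<exists>z\<in>Z. k x < k z \<and> k z < k y"
    and fin: "finite (h ` Z)"
  obtains x1 z1 x2 z2 x3 where "{x1, x2, x3} \<subseteq> Y" "{z1, z2} \<subseteq> Z"
    "k x1 < k z1" "k z1 < k x2" "k x2 < k z2" "k z2 < k x3" "h z1 = h z2"
proof -
  let ?N = "card (h ` Z)"
  have "infinite (k ` Y)" using inf inj finite_imageD by blast
  then obtain F where F: "finite F" "card F = ?N + 2" "F \<subseteq> k ` Y"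
    using infinite_arbitrarily_large by metis
  define xs where "xs = sorted_list_of_set F"
  have len: "length xs = ?N + 2" and set: "set xs \<subseteq> k ` Y"
    using F by (auto simp: xs_def)
  have sorted: "xs ! i < xs ! j" if "i < j" "j < ?N + 2" for i j
    using strict_sorted_list_of_set[of F] that len sorted_wrt_nth_less unfolding xs_def by metis
  have "\<exists>x. \<forall>i<?N + 2. x i \<in> Y \<and> k (x i) = xs ! i"
  proof (intro choice_iff[THEN iffD1] allI)
    fix i
    show "\<exists>y. i < ?N + 2 \<longrightarrow> y \<in> Y \<and> k y = xs ! i"
    proof (cases "i < ?N + 2")
      case True
      then have "xs ! i \<in> k ` Y" using set len nth_mem[of i xs] by auto
      then show ?thesis by auto
    qed simp
  qed
  then obtain x where x: "\<And>i. i < ?N + 2 \<Longrightarrow> x i \<in> Y" "\<And>i. i < ?N + 2 \<Longrightarrow> k (x i) = xs ! i"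
    by blast
  have "\<exists>z. \<forall>i. i < ?N + 1 \<longrightarrow> z i \<in> Z \<and> k (x i) < k (z i) \<and> k (z i) < k (x (Suc i))"
  proof (intro choice_iff[THEN iffD1] allI)
    fix i
    show "\<exists>z. i < ?N + 1 \<longrightarrow> z \<in> Z \<and> k (x i) < k z \<and> k z < k (x (Suc i))"
      using sep[of "x i" "x (Suc i)"] x[of i] x[of "Suc i"] sorted[of i "Suc i"]
      by (cases "i < ?N + 1") auto
  qed
  then obtain z where z: "\<And>i. i < ?N + 1 \<Longrightarrow> z i \<in> Z"
    "\<And>i. i < ?N + 1 \<Longrightarrow> k (x i) < k (z i)" "\<And>i. i < ?N + 1 \<Longrightarrow> k (z i) < k (x (Suc i))"
    by blast
  have "card ((\<lambda>i. h (z i)) ` {..<?N + 1}) \<le> ?N"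
    using fin z by (intro card_mono) auto
  then have "\<not> inj_on (\<lambda>i. h (z i)) {..<?N + 1}"
    by (intro pigeonhole) simp
  then obtain i j where ij: "i < j" "j < ?N + 1" "h (z i) = h (z j)"
    unfolding inj_on_def by (metis lessThan_iff linorder_neqE_nat)
  have "k (x (Suc i)) \<le> k (x j)"
    using x(2)[of "Suc i"] x(2)[of j] sorted[of "Suc i" j] ij by (cases "Suc i = j") auto
  then have "k (x (Suc i)) < k (z j)" using z(2)[of j] ij by auto
  then show thesis using that[of "x i" "x (Suc i)" "x (Suc j)" "z i" "z j"] x z ij by auto
qed

section \<open>Infinitely many convex classes yield an entangled cycle\<close>

lemma state_interval_memI:
  assumes "x \<in> words_to M u" "y \<in> words_to M u" "of_word x < g" "g < of_word y"
  shows "g \<in> state_interval M u"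
  unfolding state_interval_def greaterThanLessThan_iff Inf_less_iff less_Sup_iff
  using assms by blast

text \<open>Along the common suffix \<open>g\<close>, of length at least \<open>|Q|\<^sup>2\<close>, the pair of states \<open>(u i, v i)\<close> repeats.
  Interleaving is not affected by appending a common suffix, so \<open>x2 @ take i g\<close> is a point of both
  intervals at every step; and the pairs never merge, because they differ at the end.\<close>

lemma entangled_words_cycle:
  fixes M :: "('r, 'a::{finite,linorder}) automaton"
  assumes M: "dfa M" and len: "card (states M \<times> states M) \<le> length g"
    and run: "\<And>i. i \<le> length g \<Longrightarrow> x2 @ take i g \<in> words_to M (u i) \<and>
      x1 @ take i g \<in> words_to M (u i) \<and> x3 @ take i g \<in> words_to M (u i) \<and>
      z1 @ take i g \<in> words_to M (v i) \<and> z2 @ take i g \<in> words_to M (v i)"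
    and ord: "of_word x1 < of_word z1" "of_word z1 < of_word x2" "of_word x2 < of_word z2"
      "of_word z2 < of_word x3"
    and ne: "u (length g) \<noteq> v (length g)"
  shows "\<exists>ps. cycle (square M) ps \<and>
    (\<forall>(u, v)\<in>set ps. u \<noteq> v \<and> state_interval M u \<inter> state_interval M v \<noteq> {})"
proof -
  let ?n = "length g"
  have states: "u i \<in> states M" "v i \<in> states M" if "i \<le> ?n" for i
    using run[OF that] run_source_in_states[OF M] by (auto simp: words_to_def)
  have step: "trans M (u i) (g ! i) = Some (u (Suc i))" "trans M (v i) (g ! i) = Some (v (Suc i))"
    if "i < ?n" for i
    using run[of i] run[of "Suc i"] that
    by (auto simp: words_to_def take_Suc_conv_app_nth run_snoc simp flip: append_assoc)
  have diff: "u i \<noteq> v i" if "i \<le> ?n" for i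
    using that
  proof (induction rule: inc_induct)
    case base
    then show ?case by (rule ne)
  next
    case (step i)
    then show ?case using \<open>i < ?n \<Longrightarrow> trans M (u i) (g ! i) = Some (u (Suc i))\<close>
      \<open>i < ?n \<Longrightarrow> trans M (v i) (g ! i) = Some (v (Suc i))\<close> by auto
  qed
  have int: "of_word (x2 @ take i g) \<in> state_interval M (u i) \<inter> state_interval M (v i)"
    if "i \<le> ?n" for i
  proof (rule IntI)
    note r = run[OF that]
    show "of_word (x2 @ take i g) \<in> state_interval M (u i)"
      by (rule state_interval_memI[of "x1 @ take i g" M _ "x3 @ take i g"])
        (simp_all only: r of_word_append_less_iff less_trans[OF ord(1,2)] less_trans[OF ord(3,4)])
    show "of_word (x2 @ take i g) \<in> state_interval M (v i)"
      by (rule state_interval_memI[of "z1 @ take i g" M _ "z2 @ take i g"])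
        (simp_all only: r of_word_append_less_iff ord)
  qed
  have fin: "finite (states M \<times> states M)" using M by (simp add: dfa_def)
  have "(\<lambda>i. (u i, v i)) ` {..?n} \<subseteq> states M \<times> states M" using states by auto
  \<comment> \<open>There are \<open>?n + 1\<close> indices but at most \<open>?n\<close> pairs of
    states.\<close>
  then have "card ((\<lambda>i. (u i, v i)) ` {..?n}) < card {..?n}"
    using card_mono[OF fin, of "(\<lambda>i. (u i, v i)) ` {..?n}"] len by simp
  then have "\<not> inj_on (\<lambda>i. (u i, v i)) {..?n}" by (rule pigeonhole)
  then obtain i j where ij: "i < j" "j \<le> ?n" "(u i, v i) = (u j, v j)"
    unfolding inj_on_def by (metis atMost_iff linorder_neqE_nat)
  let ?ps = "map (\<lambda>i. (u i, v i)) [i..<j]"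
  have "arrow (square M) (?ps ! m) (?ps ! (Suc m mod length ?ps))" if "m < length ?ps" for m
  proof -
    have m: "m < j - i" using that by simp
    have "?ps ! (Suc m mod length ?ps) = (u (Suc (i + m)), v (Suc (i + m)))"
    \<comment> \<open>At the last vertex the index wraps around to \<open>i\<close>, whose pair
      equals the one at \<open>j\<close>.\<close>
    proof (cases "Suc m = j - i")
      case True
      then have "Suc (i + m) = j" using ij by simp
      then show ?thesis using True ij by simp
    next
      case False
      then show ?thesis using m by simp
    qed
    moreover have "trans (square M) (?ps ! m) (g ! (i + m)) = Some (u (Suc (i + m)), v (Suc (i + m)))"
      using step[of "i + m"] m ij by (simp add: square_def)
    ultimately show ?thesis by (auto simp: arrow_def)
  qed
  moreover have "set ?ps \<subseteq> states (square M)" using states ij by (auto simp: square_def)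
  ultimately have "cycle (square M) ?ps" using ij by (auto simp: cycle_def)
  moreover have "\<forall>(u, v)\<in>set ?ps. u \<noteq> v \<and> state_interval M u \<inter> state_interval M v \<noteq> {}"
  proof -
    have "u m \<noteq> v m \<and> state_interval M (u m) \<inter> state_interval M (v m) \<noteq> {}" if "m < j" for m
    proof -
      have "m \<le> ?n" using that ij(2) by linarith
      then show ?thesis using diff[of m] int[of m] by blast
    qed
    then show ?thesis by (simp only: set_map ball_simps prod.case) simp
  qed
  ultimately show ?thesis by (intro exI conjI)
qed

abbreviation defined_words :: "('q, 'a) automaton \<Rightarrow> 'a list set" where
  "defined_words M \<equiv> {w. run M (source M) w \<noteq> None}"

text \<open>The last character is recorded because words with different last characters must reach
  different states of a Wheeler DFA; \<open>None\<close> sets the empty word apart.\<close>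

definition state_last :: "('q, 'a) automaton \<Rightarrow> 'a list \<Rightarrow> 'q option \<times> 'a option" where
  "state_last M w = (run M (source M) w, if w = [] then None else Some (last w))"

abbreviation wheeler_rel :: "('q, 'a::linorder) automaton \<Rightarrow> ('a list \<times> 'a list) set" where
  "wheeler_rel M \<equiv> convex_rel of_word (state_last M) (defined_words M)"

lemma infinite_index_entangled_cycle:
  fixes M :: "('r, 'a::{finite,linorder}) automaton"
  assumes M: "dfa M" and inf: "infinite (defined_words M // wheeler_rel M)"
  shows "\<exists>ps. cycle (square M) ps \<and>
    (\<forall>(u, v)\<in>set ps. u \<noteq> v \<and> state_interval M u \<inter> state_interval M v \<noteq> {})"
proof -
  let ?P = "defined_words M" and ?R = "wheeler_rel M"
  let ?run = "run M (source M)"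
  define n where "n = card (states M \<times> states M)"
  have "source M \<in> states M" "finite (states M)" using M by (auto simp: dfa_def)
  then have n: "0 < n" unfolding n_def by (auto simp: card_gt_0_iff)
  \<comment> \<open>the last \<open>n\<close> characters of \<open>w\<close> together with the states visited while reading them\<close>
  define h where "h w = (drop (length w - n) w,
    map (\<lambda>i. ?run (take (length w - n + i) w)) [0..<Suc n])" for w
  have h_append: "h (x @ g) = (g, map (\<lambda>i. ?run (x @ take i g)) [0..<Suc n])" if "length g = n" for x g
    using that by (simp add: h_def)
  have eq: "equiv ?P ?R" by (intro equiv_convex_rel inj_on_subset[OF inj_of_word]) simp
  have prefix: "?run w \<noteq> None" if "?run (w @ z) \<noteq> None" for w z
    using that by (auto simp: run_append split: bind_splits)
  have finh: "finite (h ` ?P)"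
  proof (rule finite_subset)
    let ?S = "Some ` states M"
    show "h ` ?P \<subseteq> {w. set w \<subseteq> UNIV \<and> length w \<le> n} \<times> {qs. set qs \<subseteq> ?S \<and> length qs \<le> Suc n}"
    proof
      fix t assume "t \<in> h ` ?P"
      then obtain w where w: "w \<in> ?P" "t = h w" by blast
      have run: "?run (take i w) \<in> ?S" for i
      proof -
        have "?run (take i w) \<noteq> None" using prefix[of "take i w" "drop i w"] w by simp
        then show ?thesis using run_source_in_states[OF M] by auto
      qed
      have "h w \<in> {w. set w \<subseteq> UNIV \<and> length w \<le> n} \<times> {qs. set qs \<subseteq> ?S \<and> length qs \<le> Suc n}"
        using run unfolding h_def mem_Times_iff fst_conv snd_conv mem_Collect_eq
        by (simp only: set_map length_map length_upt length_drop image_subset_iff) simp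
      then show "t \<in> {w. set w \<subseteq> UNIV \<and> length w \<le> n} \<times> {qs. set qs \<subseteq> ?S \<and> length qs \<le> Suc n}"
        by (simp only: w)
    qed
    have "finite ?S" using \<open>finite (states M)\<close> by simp
    then show "finite ({w::'a list. set w \<subseteq> UNIV \<and> length w \<le> n} \<times> {qs. set qs \<subseteq> ?S \<and> length qs \<le> Suc n})"
      by (intro finite_cartesian_product finite_lists_length_le) auto
  qed
  define X where "X = (\<lambda>C. SOME x. x \<in> C) ` (?P // ?R)"
  have rep: "(SOME x. x \<in> C) \<in> C" if "C \<in> ?P // ?R" for C
    using in_quotient_imp_non_empty[OF eq that] by (simp add: some_in_eq)
  have rep_eq: "C = D" if "C \<in> ?P // ?R" "D \<in> ?P // ?R" "((SOME x. x \<in> C), (SOME x. x \<in> D)) \<in> ?R" for C D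
    using quotient_eqI[OF eq that(1,2) rep rep that(3)] that by simp
  have XP: "X \<subseteq> ?P" using rep in_quotient_imp_subset[OF eq] unfolding X_def by blast
  have refl: "(x, x) \<in> ?R" if "x \<in> ?P" for x using eq that by (meson equivE refl_onD)
  have "inj_on (\<lambda>C. SOME x. x \<in> C) (?P // ?R)"
  proof (rule inj_onI)
    fix C D assume CD: "C \<in> ?P // ?R" "D \<in> ?P // ?R" "(SOME x. x \<in> C) = (SOME x. x \<in> D)"
    then have "(SOME x. x \<in> D) \<in> ?P" using XP by (auto simp: X_def)
    then have "((SOME x. x \<in> D), (SOME x. x \<in> D)) \<in> ?R" by (rule refl)
    then show "C = D" using rep_eq[OF CD(1,2)] CD(3) by simp
  qed
  then have infX: "infinite X" using inf finite_imageD unfolding X_def by blast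
  have Xrel: "(x, y) \<notin> ?R" if "x \<in> X" "y \<in> X" "x \<noteq> y" for x y
    using that rep_eq unfolding X_def by blast
  have "finite (h ` X)" using finh XP by (meson finite_subset image_mono)
  \<comment> \<open>Infinitely many representatives share the value of \<open>h\<close>; the steps
    below extract from it a common suffix \<open>g\<close> of length \<open>n\<close>.\<close>
  then obtain x0 where x0: "x0 \<in> X" "infinite {x \<in> X. h x = h x0}"
    using pigeonhole_infinite[OF infX] by blast
  define Y where "Y = {x \<in> X. h x = h x0}"
  obtain g where g: "length g = n" "\<And>x. x \<in> Y \<Longrightarrow> \<exists>x'. x = x' @ g"
  proof -
    let ?g = "drop (length x0 - n) x0"
    have suffix: "x = take (length x - n) x @ ?g" if "x \<in> Y" for x
      using that append_take_drop_id[of "length x - n" x] by (simp add: Y_def h_def)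
    \<comment> \<open>For a word shorter than \<open>n\<close>, truncated subtraction makes the
      first component of \<open>h\<close> the whole word. Then \<open>h\<close> would determine the
      word, but \<open>Y\<close> is infinite.\<close>
    have "length x0 \<ge> n"
    proof (rule ccontr)
      assume short: "\<not> n \<le> length x0"
      have "x = x0" if "x \<in> Y" for x
      proof -
        have "drop (length x - n) x = x0" using that short by (simp add: Y_def h_def)
        moreover from this have "length x \<le> n"
          using short by (metis length_drop diff_diff_cancel nat_le_linear)
        ultimately show ?thesis by simp
      qed
      then have "Y \<subseteq> {x0}" by blast
      then show False using x0(2) finite_subset unfolding Y_def by blast
    qed
    then show thesis using that[of ?g] suffix by auto
  qed
  \<comment> \<open>All words of \<open>Y\<close> reach the state of \<open>x0\<close>; the
    candidates for separating them have the same suffix but reach another state.\<close>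
  define Z where "Z = {z \<in> ?P. (\<exists>z'. z = z' @ g) \<and> ?run z \<noteq> ?run x0}"
  have sep: "\<exists>z\<in>Z. of_word x < of_word z \<and> of_word z < of_word y"
    if Y: "x \<in> Y" "y \<in> Y" "of_word x < of_word y" for x y
  proof -
    have xy: "x \<in> ?P" "y \<in> ?P" "(x, y) \<notin> ?R" using Y XP Xrel[of x y] by (auto simp: Y_def)
    moreover have "min (of_word x) (of_word y) = of_word x" "max (of_word x) (of_word y) = of_word y"
      using Y(3) by (simp_all add: min_absorb1 max_absorb2)
    ultimately obtain z where z: "z \<in> ?P" "of_word x \<le> of_word z" "of_word z \<le> of_word y"
      "state_last M z \<noteq> state_last M x"
      using convex_relI[of x ?P y of_word "state_last M"] by metis
    obtain x' y' where x': "x = x' @ g" "y = y' @ g" using g(2)[OF Y(1)] g(2)[OF Y(2)] by blast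
    obtain z' where z': "z = z' @ g"
      using common_suffix_between[of x' g z y'] z x' by auto
    \<comment> \<open>Since \<open>0 < n\<close>, the suffix \<open>g\<close> is nonempty and fixes
      the last character, so labels can differ only in the state.\<close>
    have "last w = last g" "w \<noteq> []" if "w = w' @ g" for w w'
      using that g(1) n by auto
    then have runne: "?run z \<noteq> ?run x" using z(4) x' z' by (auto simp: state_last_def)
    have run_h: "?run w = last (snd (h w))" for w by (simp add: h_def)
    have run0: "?run w = ?run x0" if "w \<in> Y" for w using that run_h[of w] run_h[of x0] by (simp add: Y_def)
    have "z \<in> Z" using z(1) z' runne run0[OF Y(1)] by (auto simp: Z_def)
    moreover have "z \<noteq> x" "z \<noteq> y" using runne run0[OF Y(1)] run0[OF Y(2)] by auto
    then have "of_word x < of_word z" "of_word z < of_word y"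
      using z inj_of_word by (auto simp: less_le dest: injD)
    ultimately show ?thesis by blast
  qed
  have finZ: "finite (h ` Z)" using finh by (rule finite_subset[rotated]) (auto simp: Z_def)
  have infY: "infinite Y" using x0(2) by (simp add: Y_def)
  have injY: "inj_on of_word Y" by (rule inj_on_subset[OF inj_of_word]) simp
  obtain x1 z1 x2 z2 x3 where Y: "{x1, x2, x3} \<subseteq> Y" and Z: "{z1, z2} \<subseteq> Z"
    and ord: "of_word x1 < of_word z1" "of_word z1 < of_word x2" "of_word x2 < of_word z2"
      "of_word z2 < of_word x3" and hz: "h z1 = h z2"
  proof (rule infinite_interleaving[OF infY injY _ finZ])
    show "\<exists>z\<in>Z. of_word x < of_word z \<and> of_word z < of_word y"
      if "x \<in> Y" "y \<in> Y" "of_word x < of_word y" for x y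
      by (rule sep[OF that])
  qed
  obtain x1' x2' x3' z1' z2' where
    split: "x1 = x1' @ g" "x2 = x2' @ g" "x3 = x3' @ g" "z1 = z1' @ g" "z2 = z2' @ g"
    using Y Z g(2) by (auto simp: Z_def) metis
  \<comment> \<open>Equal values of \<open>h\<close> make the three \<open>x\<close> words visit the
    same states along \<open>g\<close>, and likewise the two \<open>z\<close> words, so one word of
    each kind determines these states.\<close>
  define u where "u i = the (?run (x1' @ take i g))" for i
  define v where "v i = the (?run (z1' @ take i g))" for i
  have hx: "h x1 = h x2" "h x1 = h x3" using Y by (auto simp: Y_def)
  have same: "?run (a @ take i g) = ?run (b @ take i g)" if "h (a @ g) = h (b @ g)" "i \<le> n" for a b i
    using that g(1) by (auto simp: h_append)
  have def: "?run (a @ take i g) \<noteq> None" if "a @ g \<in> ?P" for a i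
    using that prefix[of "a @ take i g" "drop i g"] by simp
  have P: "x1 \<in> ?P" "z1 \<in> ?P" using Y Z XP by (auto simp: Y_def Z_def)
  have run: "x2' @ take i g \<in> words_to M (u i) \<and>
      x1' @ take i g \<in> words_to M (u i) \<and> x3' @ take i g \<in> words_to M (u i) \<and>
      z1' @ take i g \<in> words_to M (v i) \<and> z2' @ take i g \<in> words_to M (v i)" if "i \<le> length g" for i
    using same[of x1' x2' i] same[of x1' x3' i] same[of z1' z2' i] hx hz def[of x1' i] def[of z1' i] P that g(1)
    by (auto simp: split words_to_def u_def v_def)
  have ne: "u (length g) \<noteq> v (length g)"
  proof -
    have "?run x1 = ?run x0"
    proof -
      have "last (snd (h x1)) = last (snd (h x0))" using Y by (simp add: Y_def)
      then show ?thesis by (simp add: h_def)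
    qed
    moreover have "?run z1 \<noteq> ?run x0" using Z by (simp add: Z_def)
    ultimately have "?run x1 \<noteq> ?run z1" by simp
    then show ?thesis using P by (auto simp: u_def v_def split)
  qed
  show ?thesis
  proof (rule entangled_words_cycle[where g = g and u = u and v = v])
    show "card (states M \<times> states M) \<le> length g" using g(1) by (simp add: n_def)
    show "of_word x1' < of_word z1'" "of_word z1' < of_word x2'" "of_word x2' < of_word z2'"
      "of_word z2' < of_word x3'"
      using ord unfolding split of_word_append_less_iff .
  qed (fact M run ne)+
qed

section \<open>Finitely many convex classes yield a Wheeler DFA\<close>

lemma finite_index_wheeler:
  fixes M :: "('r, 'a::{finite,linorder}) automaton"
  assumes M: "dfa M" and fin: "finite (defined_words M // wheeler_rel M)"
  shows "wheeler_language (language M)"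
proof -
  let ?P = "defined_words M" and ?R = "wheeler_rel M" and ?run = "run M (source M)"
  have inj: "inj_on of_word ?P" by (rule inj_on_subset[OF inj_of_word]) simp
  obtain f :: "'a list \<Rightarrow> nat" where f: "finite (f ` ?P)"
    and mono: "\<And>x y. x \<in> ?P \<Longrightarrow> y \<in> ?P \<Longrightarrow> of_word x \<le> of_word y \<Longrightarrow> f x \<le> f y"
    and eq: "\<And>x y. x \<in> ?P \<Longrightarrow> y \<in> ?P \<Longrightarrow> f x = f y \<longleftrightarrow> (x, y) \<in> ?R"
    using convex_rel_rank[OF inj fin] by blast
  have label: "state_last M x = state_last M y" if "x \<in> ?P" "y \<in> ?P" "f x = f y" for x y
    using that eq convex_rel_label by metis
  have run: "?run x = ?run y" if "x \<in> ?P" "y \<in> ?P" "f x = f y" for x y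
    using label[OF that] by (simp add: state_last_def)
  interpret right_invariant ?P f "language M"
  proof
    show "[] \<in> ?P" by simp
    show "w \<in> ?P" if "w @ [a] \<in> ?P" for w a using that by (auto simp: run_snoc split: bind_splits)
    show "finite (f ` ?P)" by (fact f)
    show L: "language M \<subseteq> ?P" by (auto simp: mem_language_iff)
    show step: "w' @ [a] \<in> ?P" if "w \<in> ?P" "w' \<in> ?P" "f w = f w'" "w @ [a] \<in> ?P" for w w' a
      using run[OF that(1-3)] that by (auto simp: run_snoc)
    show "w \<in> language M" if "w \<in> ?P" "w' \<in> language M" "f w = f w'" for w w'
      using run[of w w'] that L by (auto simp: mem_language_iff)
    show "f (w @ [a]) = f (w' @ [a])" if w: "w \<in> ?P" "w' \<in> ?P" "f w = f w'" "w @ [a] \<in> ?P" for w w' a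
    proof -
      have R: "(w, w') \<in> ?R" using eq w by blast
      \<comment> \<open>A word between the two extensions also ends in \<open>a\<close>. Without
        this character it lies between \<open>w\<close> and \<open>w'\<close>, so it reaches the
        same state as \<open>w\<close>, and reading \<open>a\<close> keeps the labels equal.\<close>
      have between: "state_last M z = state_last M (w @ [a])"
        if z: "z \<in> ?P" "min (of_word (w @ [a])) (of_word (w' @ [a])) \<le> of_word z"
          "of_word z \<le> max (of_word (w @ [a])) (of_word (w' @ [a]))" for z
      proof -
        obtain z' where z': "z = z' @ [a]"
          using common_suffix_between[of w "[a]" z w'] common_suffix_between[of w' "[a]" z w]
            common_suffix_between[of w "[a]" z w] common_suffix_between[of w' "[a]" z w'] z(2,3)
          unfolding min_le_iff_disj le_max_iff_disj by metis
        have "z' \<in> ?P" using z(1) z' by (auto simp: run_snoc split: bind_splits)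
        moreover have "min (of_word w) (of_word w') \<le> of_word z'"
          "of_word z' \<le> max (of_word w) (of_word w')"
          using z(2,3) z' unfolding min_le_iff_disj le_max_iff_disj by auto
        ultimately have "state_last M z' = state_last M w"
          by (rule convex_relD[OF R])
        then show ?thesis by (simp add: z' state_last_def run_snoc)
      qed
      have w': "w' @ [a] \<in> ?P" using step w by blast
      have "(w @ [a], w' @ [a]) \<in> ?R"
        by (rule convex_relI[OF w(4) w']) (rule between)
      then show ?thesis using eq[OF w(4) w'] by (rule iffD2[rotated])
    qed
  qed
  \<comment> \<open>Class numbers grow with the words in co-lexicographic order, so the order of
    \<open>nat\<close> serves as the Wheeler order.\<close>
  let ?r = "{(p, q). p \<in> f ` ?P \<and> q \<in> f ` ?P \<and> p < q}"
  have "wheeler_order A ?r"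
    unfolding wheeler_order_def
  proof (intro conjI ballI allI impI)
    show "?r \<subseteq> states A \<times> states A" unfolding states_quotient by blast
    show "strict_linear_order_on (states A) ?r"
      unfolding states_quotient
      by (auto simp: strict_linear_order_on_def Relation.trans_def irrefl_def total_on_def)
    show "(source A, u) \<in> ?r" if u: "u \<in> states A - {source A}" for u
    proof -
      obtain w where w: "w \<in> ?P" "u = f w" using u unfolding states_quotient by blast
      have "of_word [] \<le> of_word w" by (simp add: not_less[symmetric])
      then have "f [] \<le> f w" by (rule mono[OF Nil w(1)])
      moreover have "f [] \<noteq> f w" using u w(2) unfolding source_quotient by auto
      ultimately show ?thesis using w Nil unfolding source_quotient by simp
    qed
    show "(u', v') \<in> ?r"
      if uv: "u \<in> states A" "v \<in> states A"
        "trans A u a = Some u' \<and> trans A v b = Some v' \<and> a < b" for u v a b u' v'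
    proof -
      obtain x y where x: "x \<in> ?P" "u = f x" and y: "y \<in> ?P" "v = f y"
        using uv unfolding states_quotient by blast
      have x': "x @ [a] \<in> ?P" "u' = f (x @ [a])"
        using uv(3) trans_quotient[OF x(1), of a] unfolding x(2) by (metis option.distinct(1) option.inject)+
      have y': "y @ [b] \<in> ?P" "v' = f (y @ [b])"
        using uv(3) trans_quotient[OF y(1), of b] unfolding y(2) by (metis option.distinct(1) option.inject)+
      have "f (x @ [a]) \<le> f (y @ [b])" using mono[OF x'(1) y'(1)] uv by simp
      \<comment> \<open>Different last characters mean different labels, hence different classes,
        which makes the inequality strict.\<close>
      moreover have "f (x @ [a]) \<noteq> f (y @ [b])"
        using label[OF x'(1) y'(1)] uv by (auto simp: state_last_def)
      ultimately show ?thesis using x' y' by (simp add: le_less)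
    qed
    show "(u', v') \<in> ?r"
      if uv: "u \<in> states A" "v \<in> states A"
        "trans A u a = Some u' \<and> trans A v a = Some v' \<and> u' \<noteq> v' \<and> (u, v) \<in> ?r" for u v a u' v'
    proof -
      obtain x y where x: "x \<in> ?P" "u = f x" and y: "y \<in> ?P" "v = f y"
        using uv unfolding states_quotient by blast
      have x': "x @ [a] \<in> ?P" "u' = f (x @ [a])"
        using uv(3) trans_quotient[OF x(1), of a] unfolding x(2) by (metis option.distinct(1) option.inject)+
      have y': "y @ [a] \<in> ?P" "v' = f (y @ [a])"
        using uv(3) trans_quotient[OF y(1), of a] unfolding y(2) by (metis option.distinct(1) option.inject)+
      have "f x < f y" using uv x y by auto
      then have "of_word x \<le> of_word y" using mono[OF y(1) x(1)] by force
      then have "f (x @ [a]) \<le> f (y @ [a])" using mono[OF x'(1) y'(1)] by simp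
      then show ?thesis using x' y' uv(3) by (simp add: le_less)
    qed
  qed
  then show ?thesis
    using dfa_quotient language_quotient unfolding wheeler_language_def wheeler_dfa_def by blast
qed

theorem theorem3:
  fixes A :: "('q, 'a::{finite,linorder}) automaton"
    and M :: "('r, 'a) automaton"
  assumes "dfa A"
    and "minimum_dfa M (language A)"
  shows "\<not> wheeler_language (language A) \<longleftrightarrow>
    (\<exists>ps. cycle (square M) ps \<and>
      (\<forall>(u, v)\<in>set ps. u \<noteq> v \<and> state_interval M u \<inter> state_interval M v \<noteq> {}))"
    (is "_ \<longleftrightarrow> ?cycle")
proof
  have M: "dfa M" "language M = language A" using assms(2) by (auto simp: minimum_dfa_def)
  assume "\<not> wheeler_language (language A)"
  then show ?cycle
    using infinite_index_entangled_cycle[OF M(1)] finite_index_wheeler[OF M(1)] M(2) by auto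
next
  assume ?cycle
  then obtain ps where ps: "cycle (square M) ps"
    and ent: "\<forall>(u, v)\<in>set ps. u \<noteq> v \<and> state_interval M u \<inter> state_interval M v \<noteq> {}"
    by (elim exE conjE)
  obtain u v where uv: "ps ! 0 = (u, v)" by (cases "ps ! 0")
  have ne: "ps \<noteq> []" and sub: "set ps \<subseteq> states (square M)" using ps by (auto simp: cycle_def)
  then have mem: "(u, v) \<in> set ps" using uv nth_mem[of 0 ps] by simp
  then have states: "u \<in> states M" "v \<in> states M" using sub by (auto simp: square_def)
  \<comment> \<open>One full turn: the index \<open>length ps\<close> wraps to \<open>0\<close>, so
    the label \<open>w\<close> leads both \<open>u\<close> and \<open>v\<close> back to
    themselves.\<close>
  obtain w where w: "length w = length ps" "run (square M) (u, v) w = Some (u, v)"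
    using cycle_run[OF ps, of "length ps"] uv by auto
  then have "w \<noteq> []" using ne by auto
  then show "\<not> wheeler_language (language A)"
    using entangled_cycle_not_wheeler[OF assms(2) states] bspec[OF ent mem] w(2)
    by (simp add: run_square)
qed

end
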